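(* For a typical function $f\in C([0,1])$ there are sets $A\subseteq[0,1]$ and $B\subseteq\mathbb{R}$ such that $\underline{\dim}_{\mathsf P}A=0$, $\dim_{\mathsf H}B=0$, and the graph of $f$ is contained in $(A\times\mathbb{R})\cup(\mathbb{R}\times B)$.
   Context: $C([0,1])$ is the space of continuous functions $[0,1]\to\mathbb{R}$ with the sup norm. "For a typical $f$ ... holds" means: there is a comeager set $\mathcal{F}\subseteq C([0,1])$ such that every $f\in\mathcal{F}$ has the property. Lower packing dimension $\underline{\dim}_{\mathsf P}$: for $\delta>0$ let $N_\delta(E)$ be the least number of sets of diameter at most $\delta$ needed to cover $E$. For $s>0$ let $\boldsymbol{\nu}^s_0(E)=\liminf_{\delta\to0}N_\delta(E)\delta^s$ and $\boldsymbol{\nu}^s(E)=\inf\{\sum_n\boldsymbol{\nu}^s_0(E_n):\{E_n\}\text{ a countable cover of }E\}$. Then $\underline{\dim}_{\mathsf P}E=\sup\{s>0:\boldsymbol{\nu}^s(E)>0\}$ ($\sup\emptyset=0$). $\dim_{\mathsf H}$ is the usual Hausdorff dimension (the empty set has dimension $0$). *)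

theory Defs
  imports "HOL-Analysis.Analysis"
begin

definition nowhere_dense_in :: "'a topology \<Rightarrow> 'a set \<Rightarrow> bool" where
  "nowhere_dense_in X S \<longleftrightarrow> S \<subseteq> topspace X \<and> X interior_of (X closure_of S) = {}"

definition meager_in :: "'a topology \<Rightarrow> 'a set \<Rightarrow> bool" where
  "meager_in X S \<longleftrightarrow> (\<exists>T :: nat \<Rightarrow> 'a set. (\<forall>n. nowhere_dense_in X (T n)) \<and> S = (\<Union>n. T n))"

definition comeager_in :: "'a topology \<Rightarrow> 'a set \<Rightarrow> bool" where
  "comeager_in X S \<longleftrightarrow> S \<subseteq> topspace X \<and> meager_in X (topspace X - S)"

text \<open>Elements of \<open>C01\<close> are represented by functions that take the fixed value \<^const>\<open>undefined\<close>
  outside \<open>[0,1]\<close>; the metric is the supremum metric over \<open>[0,1]\<close>.\<close>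

definition C01 :: "(real \<Rightarrow> real) metric" where
  "C01 = cfunspace (top_of_set {0..1}) euclidean_metric"

definition typical_in_C01 :: "((real \<Rightarrow> real) \<Rightarrow> bool) \<Rightarrow> bool" where
  "typical_in_C01 P \<longleftrightarrow> (\<exists>F. comeager_in (mtopology_of C01) F \<and> (\<forall>f\<in>F. P f))"

text \<open>The library's \<^const>\<open>diameter\<close> is real-valued and meaningless on unbounded sets, which
  have infinite diameter; hence the explicit boundedness requirement.\<close>

definition diam_at_most :: "real \<Rightarrow> 'a::metric_space set \<Rightarrow> bool" where
  "diam_at_most \<delta> U \<longleftrightarrow> bounded U \<and> diameter U \<le> \<delta>"

text \<open>The value is \<open>\<infinity>\<close> if there is no finite cover of the required kind.\<close>

definition covering_number :: "real \<Rightarrow> 'a::metric_space set \<Rightarrow> ennreal" where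
  "covering_number \<delta> E =
     (INF \<U>\<in>{\<U>. finite \<U> \<and> (\<forall>U\<in>\<U>. diam_at_most \<delta> U) \<and> E \<subseteq> \<Union>\<U>}. of_nat (card \<U>))"

definition lower_packing_premeasure :: "real \<Rightarrow> 'a::metric_space set \<Rightarrow> ennreal" where
  "lower_packing_premeasure s E =
     Liminf (at_right 0) (\<lambda>\<delta>. covering_number \<delta> E * ennreal (\<delta> powr s))"

text \<open>Here and below, covers indexed by \<open>nat\<close> include finite ones, since they may be padded
  with empty sets, which contribute nothing.\<close>

definition lower_packing_measure :: "real \<Rightarrow> 'a::metric_space set \<Rightarrow> ennreal" where
  "lower_packing_measure s E =
     (INF D\<in>{D :: nat \<Rightarrow> 'a set. E \<subseteq> (\<Union>n. D n)}. \<Sum>n. lower_packing_premeasure s (D n))"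

definition lower_packing_dim :: "'a::metric_space set \<Rightarrow> ennreal" where
  "lower_packing_dim E = (SUP s\<in>{s. 0 < s \<and> lower_packing_measure s E > 0}. ennreal s)"

definition hausdorff_premeasure :: "real \<Rightarrow> real \<Rightarrow> 'a::metric_space set \<Rightarrow> ennreal" where
  "hausdorff_premeasure s \<delta> E =
     (INF U\<in>{U :: nat \<Rightarrow> 'a set. (\<forall>n. diam_at_most \<delta> (U n)) \<and> E \<subseteq> (\<Union>n. U n)}.
        \<Sum>n. ennreal (diameter (U n) powr s))"

definition hausdorff_measure :: "real \<Rightarrow> 'a::metric_space set \<Rightarrow> ennreal" where
  "hausdorff_measure s E = (SUP \<delta>\<in>{0<..}. hausdorff_premeasure s \<delta> E)"

text \<open>The exponent \<open>s = 0\<close> is left out because \<open>0 powr 0 = 0\<close>, so that the term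
  \<^term>\<open>hausdorff_measure 0\<close> is not the counting measure; this does not affect the infimum.\<close>

definition hausdorff_dim :: "'a::metric_space set \<Rightarrow> ennreal" where
  "hausdorff_dim E = (INF s\<in>{s. 0 < s \<and> hausdorff_measure s E = 0}. ennreal s)"

end

theory Submission
  imports Defs
begin

text \<open>
  Composing \<open>f\<close> with a continuous staircase \<open>\<phi>\<close> close to the identity gives a function that takes
  only \<open>N + 1\<close> values outside \<open>N\<close> intervals of length \<open>r\<close>, where \<open>r\<close> may be chosen as small as
  desired after \<open>N\<close>. Hence for every \<open>n\<close> there is a dense open set of functions \<open>f\<close> such that,
  for some \<open>M\<close> and some \<open>r\<close> with \<open>M r\<^sup>s \<le> 2\<^sup>-\<^sup>n\<close> and \<open>s = 1 / (n + 1)\<close>, each \<open>x\<close> lies in the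
  union \<open>V\<^sub>n\<close> of \<open>M\<close> intervals of length \<open>r\<close> or \<open>f x\<close> lies in a similar union \<open>U\<^sub>n\<close>. For \<open>f\<close> in
  all these sets take \<open>B = limsup U\<^sub>n\<close>, whose Hausdorff measures vanish by summing the geometric
  series. If \<open>f x \<notin> B\<close>, then \<open>x\<close> lies in \<open>A = liminf V\<^sub>n\<close>, a countable union of sets that are
  covered by \<open>V\<^sub>n\<close> for all large \<open>n\<close>.
\<close>

section \<open>Category in the space of continuous functions\<close>

lemma comeager_in_Inter_interior_of:
  assumes "\<And>n :: nat. X closure_of (X interior_of G n) = topspace X"
  shows "comeager_in X (topspace X \<inter> (\<Inter>n. X interior_of G n))"
proof -
  have "nowhere_dense_in X (topspace X - X interior_of G n)" for n
    unfolding nowhere_dense_in_def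
    by (simp add: closure_of_complement interior_of_complement assms)
  moreover have "topspace X - topspace X \<inter> (\<Inter>n. X interior_of G n)
      = (\<Union>n. topspace X - X interior_of G n)"
    by auto
  ultimately show ?thesis
    unfolding comeager_in_def meager_in_def
    by (intro conjI exI[of _ "\<lambda>n. topspace X - X interior_of G n"]) auto
qed

lemma mspace_C01:
  "mspace C01 = {f. f \<in> extensional {0..1} \<and> continuous_on {0..1} f}"
proof -
  have "compactin (top_of_set {0..1::real}) (topspace (top_of_set {0..1}))"
    by (simp add: compactin_subtopology)
  from compactin_mspace_cfunspace[OF this, of euclidean_metric] show ?thesis
    by (auto simp: C01_def continuous_map_into_fulltopology)
qed

lemma mdist_C01_le:
  assumes "0 \<le> e" "\<And>x. x \<in> {0..1} \<Longrightarrow> \<bar>f x - g x\<bar> \<le> e"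
  shows "mdist C01 f g \<le> e"
  unfolding C01_def by (rule mdist_cfunspace_le) (use assms in \<open>auto simp: dist_real_def\<close>)

lemma abs_diff_le_mdist_C01:
  assumes "f \<in> mspace C01" "g \<in> mspace C01" "x \<in> {0..1}"
  shows "\<bar>f x - g x\<bar> \<le> mdist C01 f g"
  using mdist_cfunspace_imp_mdist_le[OF assms(1,2)[unfolded C01_def] order.refl, of x] assms(3)
  by (simp add: C01_def dist_real_def)

text \<open>A ball around \<open>g\<close> inside \<open>G n\<close> puts \<open>g\<close> in the
  interior of \<open>G n\<close>, so \<open>dense\<close> makes each of these interiors dense.
  Pointwise bounds keep the metric of \<open>C01\<close> out of the later arguments.\<close>

lemma typical_in_C01I:
  fixes G :: "nat \<Rightarrow> (real \<Rightarrow> real) set"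
  assumes dense: "\<And>n f e. f \<in> mspace C01 \<Longrightarrow> 0 < e \<Longrightarrow>
      \<exists>g\<in>mspace C01. \<exists>d>0. (\<forall>x\<in>{0..1}. \<bar>f x - g x\<bar> \<le> e) \<and>
        (\<forall>h. (\<forall>x\<in>{0..1}. \<bar>g x - h x\<bar> \<le> d) \<longrightarrow> h \<in> G n)"
    and P: "\<And>f. f \<in> (\<Inter>n. G n) \<Longrightarrow> P f"
  shows "typical_in_C01 P"
proof -
  interpret C: Metric_space "mspace C01" "mdist C01"
    by (rule Metric_space_mspace_mdist)
  let ?X = "mtopology_of C01"
  have X: "?X = C.mtopology"
    by (simp add: mtopology_of_def)
  have "?X closure_of (?X interior_of G n) = topspace ?X" for n
  proof -
    have "\<exists>g. g \<in> ?X interior_of G n \<and> g \<in> C.mball f r"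
      if f: "f \<in> mspace C01" and "0 < r" for f r
    proof -
      \<comment> \<open>Half the radius is used because pointwise bounds give only a non-strict
        bound on the distance, while the ball asks for a strict one.\<close>
      obtain g d where g: "g \<in> mspace C01" "0 < d" "\<forall>x\<in>{0..1}. \<bar>f x - g x\<bar> \<le> r / 2"
        "\<And>h. (\<forall>x\<in>{0..1}. \<bar>g x - h x\<bar> \<le> d) \<Longrightarrow> h \<in> G n"
        using dense[OF f, of "r/2" n] \<open>0 < r\<close> by auto
      have "h \<in> G n" if "h \<in> C.mball g d" for h
        using that by (intro g(4)) (use abs_diff_le_mdist_C01[of g h] in force)
      then have "C.mball g d \<subseteq> ?X interior_of G n"
        by (intro interior_of_maximal) (auto simp: X)
      moreover have "g \<in> C.mball g d"
        using g by simp
      moreover have "mdist C01 f g \<le> r / 2"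
        using g(3) \<open>0 < r\<close> by (intro mdist_C01_le) auto
      then have "g \<in> C.mball f r"
        using f g(1) \<open>0 < r\<close> by simp
      ultimately show ?thesis by blast
    qed
    then show ?thesis
      by (auto simp: X C.metric_closure_of)
  qed
  from comeager_in_Inter_interior_of[of ?X G, OF this] show ?thesis
    unfolding typical_in_C01_def
    by (intro exI conjI) (use interior_of_subset[of ?X] in \<open>auto intro!: P\<close>)
qed

section \<open>Staircases close to the identity\<close>

text \<open>A sum of \<open>N\<close> short ramps of height \<open>1 / N\<close> is monotone and
  fixes every node \<open>j / N\<close>; monotonicity then traps \<open>\<phi> x\<close> between the
  nodes on either side of \<open>x\<close>.\<close>

lemma staircase:
  fixes N :: nat and r :: real
  assumes "0 < N" "0 < r" "r \<le> 1 / N"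
  obtains \<phi> :: "real \<Rightarrow> real"
  where "continuous_on UNIV \<phi>"
    and "\<And>x. x \<in> {0..1} \<Longrightarrow> \<phi> x \<in> {0..1}"
    and "\<And>x. x \<in> {0..1} \<Longrightarrow> \<bar>\<phi> x - x\<bar> \<le> 1 / N"
    and "\<And>x. (\<exists>j<N. x \<in> {j / N..j / N + r}) \<or> (\<exists>j\<le>N. \<phi> x = j / N)"
proof
  \<comment> \<open>\<open>c k\<close> climbs linearly from 0 to 1 on
    \<open>{k / N..k / N + r}\<close>.\<close>
  define c where "c = (\<lambda>k x. max 0 (min 1 ((x - real k / N) / r)))"
  define \<phi> where "\<phi> = (\<lambda>x. (\<Sum>k<N. c k x) / N)"
  show "continuous_on UNIV \<phi>"
    unfolding \<phi>_def c_def using assms by (intro continuous_intros) auto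
  have mono: "\<phi> x \<le> \<phi> y" if "x \<le> y" for x y
    unfolding \<phi>_def c_def using that assms
    by (intro divide_right_mono sum_mono max.mono min.mono) auto
  have node: "\<phi> (j / N) = j / N" if "j \<le> N" for j
  proof -
    \<comment> \<open>Since \<open>r \<le> 1 / N\<close>, ramps that start before
      \<open>j / N\<close> are complete there, and the others have not begun.\<close>
    have "c k (j / N) = (if k < j then 1 else 0)" for k
    proof (cases "k < j")
      case True
      then have "1 / N \<le> real j / N - k / N"
        using assms by (simp add: field_simps)
      with assms(2,3) show ?thesis
        using True by (simp add: c_def min_def)
    next
      case False
      then have "real j / N - k / N \<le> 0"
        using assms by (simp add: field_simps)
      with assms(2) show ?thesis
        using False by (simp add: c_def divide_nonpos_pos)
    qed
    then have "(\<Sum>k<N. c k (j / N)) = (\<Sum>k<N. if k < j then 1 else 0)"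
      by simp
    also have "\<dots> = real (card ({..<N} \<inter> {k. k < j}))"
      by (simp add: sum.If_cases)
    also have "{..<N} \<inter> {k. k < j} = {..<j}"
      using that by auto
    finally show ?thesis
      by (simp add: \<phi>_def)
  qed
  show "\<phi> x \<in> {0..1}" if "x \<in> {0..1}" for x
    using mono[of 0 x] mono[of x 1] node[of 0] node[of N] that assms by auto
  show "\<bar>\<phi> x - x\<bar> \<le> 1 / N" if x: "x \<in> {0..1}" for x
  \<comment> \<open>At \<open>x = 1\<close> the floor below would be \<open>N\<close>, and
    \<open>node\<close> says nothing about \<open>Suc N / N\<close>.\<close>
  proof (cases "x = 1")
    case True
    then show ?thesis using node[of N] assms by simp
  next
    case False
    define j where "j = nat \<lfloor>N * x\<rfloor>"
    have "real j = \<lfloor>N * x\<rfloor>"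
      using x by (simp add: j_def)
    then have j: "real j \<le> N * x" "N * x < j + 1"
      by linarith+
    moreover have "real N * x < real N * 1"
      using x False assms(1) by (intro mult_strict_left_mono) auto
    ultimately have "j < N"
      by linarith
    have "j / N \<le> x" "x \<le> Suc j / N"
      using j assms(1) by (auto simp: field_simps)
    moreover from mono[OF this(1)] mono[OF this(2)]
    have "j / N \<le> \<phi> x" "\<phi> x \<le> Suc j / N"
      using \<open>j < N\<close> by (simp_all add: node del: of_nat_Suc)
    moreover have "Suc j / N = j / N + 1 / N"
      by (simp add: add_divide_distrib)
    ultimately show ?thesis by linarith
  qed
  show "(\<exists>j<N. x \<in> {j / N..j / N + r}) \<or> (\<exists>j\<le>N. \<phi> x = j / N)" for x
  proof (rule disj_imp[THEN iffD2], rule impI)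
    assume "\<not> (\<exists>j<N. x \<in> {j / N..j / N + r})"
    then have x: "x \<notin> {j / N..j / N + r}" if "j < N" for j
      using that by blast
    \<comment> \<open>Off the ramps every \<open>c k\<close> is 0 or 1, so \<open>\<phi> x\<close>
      is a count divided by \<open>N\<close>.\<close>
    have "c k x = (if k / N < x then 1 else 0)" if "k < N" for k
      using x[OF that] assms(2) by (auto simp: c_def min_def max_def field_simps)
    then have "(\<Sum>k<N. c k x) = (\<Sum>k<N. if k / N < x then 1 else 0)"
      by simp
    also have "\<dots> = real (card ({..<N} \<inter> {k. k / N < x}))"
      by (simp add: sum.If_cases)
    finally have "\<phi> x = card ({..<N} \<inter> {k. k / N < x}) / N"
      by (simp add: \<phi>_def)
    moreover have "card ({..<N} \<inter> {k. k / N < x}) \<le> N"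
      using card_mono[of "{..<N}" "{..<N} \<inter> {k. k / N < x}"] by simp
    ultimately show "\<exists>j\<le>N. \<phi> x = j / N" by blast
  qed
qed

text \<open>Uniform continuity fixes \<open>N\<close> from \<open>f\<close> and \<open>e\<close>
  alone, since the distance of the staircase to the identity is bounded independently of
  \<open>r\<close>. This order of choice later allows \<open>r\<close> to be tiny compared with
  \<open>1 / N\<close>.\<close>

lemma approx_staircase:
  fixes f :: "real \<Rightarrow> real"
  assumes f: "continuous_on {0..1} f" and "0 < e"
  obtains N :: nat where "0 < N"
    and "\<And>r. 0 < r \<Longrightarrow> r \<le> 1 / N \<Longrightarrow> \<exists>g p q. continuous_on {0..1} g \<and>
      (\<forall>x\<in>{0..1}. \<bar>f x - g x\<bar> \<le> e) \<and>
      (\<forall>x. (\<exists>j<N. x \<in> {p j..p j + r}) \<or> (\<exists>j\<le>N. g x = q j))"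
proof -
  have "uniformly_continuous_on {0..1} f"
    by (intro compact_uniformly_continuous f) auto
  then obtain d where d: "0 < d"
    "\<And>x y. x \<in> {0..1} \<Longrightarrow> y \<in> {0..1} \<Longrightarrow> \<bar>x - y\<bar> < d \<Longrightarrow> \<bar>f x - f y\<bar> < e"
    using \<open>0 < e\<close> unfolding uniformly_continuous_on_def dist_real_def
    by (metis abs_minus_commute)
  obtain n where "inverse (real (Suc n)) < d"
    using reals_Archimedean[OF d(1)] by blast
  then obtain N :: nat where N: "0 < N" "1 / N < d"
    by (metis inverse_eq_divide zero_less_Suc)
  show ?thesis
  proof (rule that[OF N(1)])
    fix r :: real
    assume "0 < r" "r \<le> 1 / N"
    obtain \<phi> :: "real \<Rightarrow> real" where \<phi>: "continuous_on UNIV \<phi>"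
      "\<And>x. x \<in> {0..1} \<Longrightarrow> \<phi> x \<in> {0..1}"
      "\<And>x. x \<in> {0..1} \<Longrightarrow> \<bar>\<phi> x - x\<bar> \<le> 1 / N"
      "\<And>x. (\<exists>j<N. x \<in> {j / N..j / N + r}) \<or> (\<exists>j\<le>N. \<phi> x = j / N)"
      by (rule staircase[OF N(1) \<open>0 < r\<close> \<open>r \<le> 1 / N\<close>], rule that)
    have "continuous_on {0..1} (\<lambda>x. f (\<phi> x))"
      using \<phi>(1,2) by (intro continuous_on_compose2[OF f] continuous_on_subset[OF \<phi>(1)]) auto
    moreover have "\<bar>f x - f (\<phi> x)\<bar> \<le> e" if "x \<in> {0..1}" for x
      using d(2)[OF that \<phi>(2)[OF that]] \<phi>(3)[OF that] N(2) by (simp add: abs_minus_commute)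
    moreover have "(\<exists>j<N. x \<in> {real j / N..real j / N + r}) \<or> (\<exists>j\<le>N. f (\<phi> x) = f (j / N))"
      for x
      using \<phi>(4)[of x] by auto
    ultimately show "\<exists>g p q. continuous_on {0..1} g \<and>
      (\<forall>x\<in>{0..1}. \<bar>f x - g x\<bar> \<le> e) \<and>
      (\<forall>x. (\<exists>j<N. x \<in> {p j..p j + r}) \<or> (\<exists>j\<le>N. g x = q j))"
      by (intro exI[of _ "\<lambda>x. f (\<phi> x)"] exI[of _ "\<lambda>j. real j / N"]
          exI[of _ "\<lambda>j. f (real j / N)"] conjI allI ballI)
  qed
qed

section \<open>Criteria for vanishing dimension\<close>

lemma diam_at_most_Icc:
  fixes a r :: real
  shows "0 \<le> r \<Longrightarrow> diam_at_most r {a..a + r}"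
  by (simp add: diam_at_most_def)

lemma covering_number_le_intervals:
  fixes p :: "nat \<Rightarrow> real"
  assumes "0 \<le> r" "E \<subseteq> (\<Union>j<M. {p j..p j + r})"
  shows "covering_number r E \<le> of_nat M"
proof -
  let ?U = "(\<lambda>j. {p j..p j + r}) ` {..<M}"
  have "covering_number r E \<le> of_nat (card ?U)"
    unfolding covering_number_def by (rule INF_lower) (use assms in \<open>auto intro: diam_at_most_Icc\<close>)
  also have "\<dots> \<le> of_nat M"
    using card_image_le[of "{..<M}" "\<lambda>j. {p j..p j + r}"] by simp
  finally show ?thesis .
qed

text \<open>A lower limit at 0 is at most the lower limit along any sequence of positive scales
  tending to 0, so good covers are needed only at those scales.\<close>

lemma lower_packing_premeasure_eq_0:
  assumes r: "\<And>n. 0 < r n" "r \<longlonglongrightarrow> 0"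
    and lim: "(\<lambda>n. covering_number (r n) E * ennreal (r n powr s)) \<longlonglongrightarrow> 0"
  shows "lower_packing_premeasure s E = 0"
proof -
  let ?h = "\<lambda>\<delta>. covering_number \<delta> E * ennreal (\<delta> powr s)"
  have "filterlim r (at_right 0) sequentially"
    using r by (auto simp: filterlim_at less_imp_neq[symmetric])
  then have "Liminf (at_right 0) ?h \<le> Liminf (filtermap r sequentially) ?h"
    unfolding filterlim_def le_filter_def Liminf_def
    by (intro SUP_subset_mono) auto
  also have "\<dots> \<le> liminf (\<lambda>n. ?h (r n))"
    by (rule Liminf_filtermap_le)
  also have "\<dots> = 0"
    using lim by (intro lim_imp_Liminf) auto
  finally show ?thesis
    by (simp add: lower_packing_premeasure_def)
qed

text \<open>One countable cover serves all exponents, so the supremum runs over the empty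
  set.\<close>

lemma lower_packing_dim_eq_0:
  assumes "\<And>s n. 0 < s \<Longrightarrow> lower_packing_premeasure s (D n) = 0" "E \<subseteq> (\<Union>n :: nat. D n)"
  shows "lower_packing_dim E = 0"
proof -
  have "lower_packing_measure s E = 0" if "0 < s" for s
  proof -
    have "lower_packing_measure s E \<le> (\<Sum>n. lower_packing_premeasure s (D n))"
      unfolding lower_packing_measure_def by (rule INF_lower) (use assms in auto)
    then show ?thesis
      using assms(1)[OF that] by simp
  qed
  then have *: "{s. 0 < s \<and> lower_packing_measure s E > 0} = {}"
    by auto
  show ?thesis
    unfolding lower_packing_dim_def * by (simp add: bot_ennreal)
qed

lemma hausdorff_dim_eq_0:
  assumes "\<And>s. 0 < s \<Longrightarrow> hausdorff_measure s E = 0"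
  shows "hausdorff_dim E = 0"
proof -
  have "hausdorff_dim E \<le> 0 + ennreal e" if "0 < e" for e
    unfolding hausdorff_dim_def by (rule INF_lower2[of e]) (use assms that in auto)
  then show ?thesis
    by (metis ennreal_le_epsilon le_zero_eq)
qed

text \<open>Enumerating the pairs \<open>(k, j)\<close> by \<open>prod_decode\<close> turns the
  double family into a single sequence of covering sets.\<close>

lemma hausdorff_premeasure_le_suminf_intervals:
  fixes q :: "nat \<Rightarrow> nat \<Rightarrow> real"
  assumes r: "\<And>k. 0 \<le> r k" "\<And>k. r k \<le> \<delta>" "0 \<le> \<delta>"
    and E: "E \<subseteq> (\<Union>k. \<Union>j<M k. {q k j..q k j + r k})"
  shows "hausdorff_premeasure s \<delta> E \<le> (\<Sum>k. ennreal (M k * r k powr s))"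
proof -
  \<comment> \<open>Padding beyond \<open>M k\<close> is free: the empty set has diameter 0, and
    \<open>0 powr s = 0\<close>.\<close>
  define V where "V = (\<lambda>(k, j). if j < M k then {q k j..q k j + r k} else {})"
  have "diam_at_most \<delta> (V i)" for i
    using r(1,2)[of "fst i"] r(3) by (auto simp: V_def diam_at_most_def split: prod.split)
  moreover have "E \<subseteq> (\<Union>i. V (prod_decode i))"
  proof
    fix x assume "x \<in> E"
    then obtain k j where "j < M k" "x \<in> {q k j..q k j + r k}"
      using E by blast
    then have "x \<in> V (prod_decode (prod_encode (k, j)))"
      by (simp add: V_def)
    then show "x \<in> (\<Union>i. V (prod_decode i))" by blast
  qed
  ultimately have "hausdorff_premeasure s \<delta> E \<le> (\<Sum>i. ennreal (diameter (V (prod_decode i)) powr s))"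
    unfolding hausdorff_premeasure_def by (intro INF_lower) auto
  also have "\<dots> = (\<Sum>k. \<Sum>j. ennreal (diameter (V (k, j)) powr s))"
    by (rule suminf_ennreal_2dimen[of _ "\<lambda>i. ennreal (diameter (V i) powr s)"]) simp
  also have "(\<lambda>k. \<Sum>j. ennreal (diameter (V (k, j)) powr s)) = (\<lambda>k. ennreal (M k * r k powr s))"
  proof
    fix k
    have "(\<Sum>j. ennreal (diameter (V (k, j)) powr s))
        = (\<Sum>j<M k. ennreal (diameter (V (k, j)) powr s))"
      by (rule suminf_finite) (auto simp: V_def)
    also have "\<dots> = (\<Sum>j<M k. ennreal (r k powr s))"
      using r(1)[of k] by (intro sum.cong) (auto simp: V_def)
    also have "\<dots> = ennreal (M k * r k powr s)"
      by (simp add: ennreal_mult ennreal_of_nat_eq_real_of_nat)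
    finally show "(\<Sum>j. ennreal (diameter (V (k, j)) powr s)) = ennreal (M k * r k powr s)" .
  qed
  finally show ?thesis .
qed

lemma power_half_tendsto_0: "(\<lambda>n. (1/2) ^ n :: real) \<longlonglongrightarrow> 0"
  by (rule LIMSEQ_power_zero) simp

section \<open>Lower and upper limits of unions of intervals\<close>

context
  fixes M :: "nat \<Rightarrow> nat" and r :: "nat \<Rightarrow> real"
  assumes r: "\<And>n. 0 < r n" "\<And>n. r n \<le> (1/2) ^ n"
    and Mr: "\<And>n. M n * r n powr (1 / (real n + 1)) \<le> (1/2) ^ n"
begin

text \<open>The exponent \<open>1 / (real n + 1)\<close> drops below \<open>s\<close>, and as
  \<open>r n \<le> 1\<close> a larger exponent only lowers the power. One sequence of scales thus
  serves every \<open>s\<close>.\<close>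

lemma eventually_mult_powr_le:
  assumes "0 < s"
  shows "\<forall>\<^sub>F n in sequentially. M n * r n powr s \<le> (1/2) ^ n"
proof -
  have "(\<lambda>n. 1 / (real n + 1)) \<longlonglongrightarrow> 0"
    using LIMSEQ_inverse_real_of_nat by (simp add: inverse_eq_divide add.commute)
  then have "\<forall>\<^sub>F n in sequentially. 1 / (real n + 1) < s"
    using assms by (rule order_tendstoD)
  then show ?thesis
  proof eventually_elim
    case (elim n)
    have "r n \<le> 1"
      using r(2)[of n] power_le_one[of "1/2 :: real" n] by simp
    then have "r n powr s \<le> r n powr (1 / (real n + 1))"
      using elim r(1)[of n] by (intro powr_mono') auto
    then show ?case
      using Mr[of n] by (meson mult_left_mono of_nat_0_le_iff order_trans)
  qed
qed

lemma r_tendsto_0: "r \<longlonglongrightarrow> 0"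
  by (rule real_tendsto_sandwich[OF _ _ tendsto_const power_half_tendsto_0])
    (auto intro: always_eventually less_imp_le r)

lemma lower_packing_dim_liminf_intervals:
  "lower_packing_dim ({0..1} \<inter> (\<Union>m. \<Inter>n\<in>{m..}. \<Union>j<M n. {p n j..p n j + r n})) = 0"
proof (rule lower_packing_dim_eq_0)
  fix s :: real and m :: nat
  assume "0 < s"
  \<comment> \<open>\<open>?D\<close> lies in the union of index \<open>n\<close> for every
    \<open>n \<ge> m\<close>, hence is covered by \<open>M n\<close> intervals at scale
    \<open>r n\<close>.\<close>
  let ?D = "\<Inter>n\<in>{m..}. \<Union>j<M n. {p n j..p n j + r n}"
  have "\<forall>\<^sub>F n in sequentially.
      covering_number (r n) ?D * ennreal (r n powr s) \<le> ennreal ((1/2) ^ n)"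
    using eventually_mult_powr_le[OF \<open>0 < s\<close>] eventually_ge_at_top[of m]
  proof eventually_elim
    case (elim n)
    have "covering_number (r n) ?D \<le> of_nat (M n)"
      using elim(2) by (intro covering_number_le_intervals[where p = "p n"] less_imp_le[OF r(1)]) blast
    then have "covering_number (r n) ?D * ennreal (r n powr s) \<le> of_nat (M n) * ennreal (r n powr s)"
      by (rule mult_right_mono) simp
    also have "\<dots> = ennreal (M n * r n powr s)"
      by (simp add: ennreal_mult ennreal_of_nat_eq_real_of_nat)
    also have "\<dots> \<le> ennreal ((1/2) ^ n)"
      using elim(1) by (rule ennreal_leI)
    finally show ?case .
  qed
  moreover have "(\<lambda>n. ennreal ((1/2) ^ n)) \<longlonglongrightarrow> 0"
    using tendsto_ennrealI[OF power_half_tendsto_0] by simp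
  ultimately have "(\<lambda>n. covering_number (r n) ?D * ennreal (r n powr s)) \<longlonglongrightarrow> 0"
    by (rule tendsto_sandwich[rotated, OF _ tendsto_const]) simp
  then show "lower_packing_premeasure s ?D = 0"
    by (rule lower_packing_premeasure_eq_0[OF r(1) r_tendsto_0])
qed auto

lemma hausdorff_dim_limsup_intervals:
  "hausdorff_dim (\<Inter>m. \<Union>n\<in>{m..}. \<Union>j<M n. {q n j..q n j + r n}) = 0"
    (is "hausdorff_dim ?B = 0")
proof (rule hausdorff_dim_eq_0)
  fix s :: real
  assume "0 < s"
  have "hausdorff_premeasure s \<delta> ?B = 0" if "0 < \<delta>" for \<delta>
  proof -
    \<comment> \<open>The tail from \<open>m\<close> on is used as the cover: \<open>m\<close> is so
      large that the power bound holds at all later indices and the intervals there are shorter than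
      \<open>\<delta>\<close>.\<close>
    have "\<forall>\<^sub>F m in sequentially. hausdorff_premeasure s \<delta> ?B \<le> ennreal (2 * (1/2) ^ m)"
      using eventually_all_ge_at_top[OF eventually_mult_powr_le[OF \<open>0 < s\<close>]]
        order_tendstoD(2)[OF power_half_tendsto_0 \<open>0 < \<delta>\<close>]
    proof eventually_elim
      case (elim m)
      have le: "r (k + m) \<le> \<delta>" for k
      proof -
        have "r (k + m) \<le> (1/2) ^ (k + m)" by (rule r)
        also have "\<dots> \<le> (1/2) ^ m" by (rule power_decreasing) auto
        finally show ?thesis using elim by simp
      qed
      have "?B \<subseteq> (\<Union>k. \<Union>j<M (k + m). {q (k + m) j..q (k + m) j + r (k + m)})"
      proof
        fix x assume "x \<in> ?B"
        then obtain n where "m \<le> n" "x \<in> (\<Union>j<M n. {q n j..q n j + r n})"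
          by blast
        then show "x \<in> (\<Union>k. \<Union>j<M (k + m). {q (k + m) j..q (k + m) j + r (k + m)})"
          by (intro UN_I[of "n - m" UNIV]) simp_all
      qed
      then have "hausdorff_premeasure s \<delta> ?B \<le> (\<Sum>k. ennreal (M (k + m) * r (k + m) powr s))"
        using that by (intro hausdorff_premeasure_le_suminf_intervals le less_imp_le[OF r(1)]) auto
      also have "\<dots> \<le> (\<Sum>k. ennreal ((1/2) ^ m * (1/2) ^ k))"
        using elim(1) by (intro suminf_le ennreal_leI) (auto simp flip: power_add simp: add.commute)
      also have "\<dots> = ennreal (2 * (1/2) ^ m)"
      proof (rule suminf_ennreal_eq)
        show "(\<lambda>k. (1/2) ^ m * (1/2) ^ k) sums (2 * (1/2) ^ m :: real)"
          using sums_mult[OF geometric_sums[of "1/2 :: real"], of "(1/2) ^ m"]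
          by (simp add: mult.commute)
      qed simp
      finally show ?case .
    qed
    moreover have "(\<lambda>m. ennreal (2 * (1/2) ^ m)) \<longlonglongrightarrow> 0"
      using tendsto_ennrealI[OF tendsto_mult_right_zero[OF power_half_tendsto_0, of 2]] by simp
    ultimately have "hausdorff_premeasure s \<delta> ?B \<le> 0"
      by (intro tendsto_lowerbound) auto
    then show ?thesis by simp
  qed
  then show "hausdorff_measure s ?B = 0"
    by (simp add: hausdorff_measure_def)
qed

end

section \<open>Density of the covering condition, and the conclusion\<close>

definition strip_covered :: "nat \<Rightarrow> (real \<Rightarrow> real) \<Rightarrow> nat \<Rightarrow> real \<Rightarrow> (nat \<Rightarrow> real) \<Rightarrow> (nat \<Rightarrow> real) \<Rightarrow> bool"
  where "strip_covered n f M r p q \<longleftrightarrow>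
    0 < r \<and> r \<le> (1/2) ^ n \<and> M * r powr (1 / (real n + 1)) \<le> (1/2) ^ n \<and>
    (\<forall>x\<in>{0..1}. \<exists>j<M. x \<in> {p j..p j + r} \<or> f x \<in> {q j..q j + r})"

text \<open>Off the ramps \<open>g\<close> takes finitely many values, and a perturbation by at most
  \<open>r / 2\<close> stays in the intervals of length \<open>r\<close> centred at them.\<close>

lemma strip_covered_dense:
  assumes f: "f \<in> mspace C01" and "0 < e"
  shows "\<exists>g\<in>mspace C01. \<exists>d>0. (\<forall>x\<in>{0..1}. \<bar>f x - g x\<bar> \<le> e) \<and>
    (\<forall>h. (\<forall>x\<in>{0..1}. \<bar>g x - h x\<bar> \<le> d) \<longrightarrow> (\<exists>M r p q. strip_covered n h M r p q))"
proof -
  have cont: "continuous_on {0..1} f"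
    using f by (simp add: mspace_C01)
  obtain N :: nat where N: "0 < N"
    and approx: "\<And>r. 0 < r \<Longrightarrow> r \<le> 1 / N \<Longrightarrow> \<exists>g p q. continuous_on {0..1} g \<and>
      (\<forall>x\<in>{0..1}. \<bar>f x - g x\<bar> \<le> e) \<and>
      (\<forall>x. (\<exists>j<N. x \<in> {p j..p j + r}) \<or> (\<exists>j\<le>N. g x = q j))"
    by (rule approx_staircase[OF cont \<open>0 < e\<close>], rule that)
  have id: "((\<lambda>r. r) \<longlongrightarrow> 0) (at_right (0 :: real))"
    by (rule tendsto_ident_at)
  \<comment> \<open>There are \<open>N\<close> ramps but \<open>N + 1\<close> values, so
    \<open>Suc N\<close> bounds both counts. The exponent is positive, so the limit is 0.\<close>
  have "((\<lambda>r. Suc N * r powr (1 / (real n + 1)))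
      \<longlongrightarrow> Suc N * 0 powr (1 / (real n + 1))) (at_right (0 :: real))"
    by (intro tendsto_intros tendsto_powr2 id)
      (auto simp: eventually_at_right_less intro: eventually_at_rightI[of 0 1])
  then have "\<forall>\<^sub>F r in at_right (0 :: real). Suc N * r powr (1 / (real n + 1)) < (1/2) ^ n"
    by (rule order_tendstoD) simp
  moreover have "\<forall>\<^sub>F r in at_right (0 :: real). r < 1 / N"
    by (rule order_tendstoD[OF id]) (use N in simp)
  moreover have "\<forall>\<^sub>F r in at_right (0 :: real). r < (1/2) ^ n"
    by (rule order_tendstoD[OF id]) simp
  moreover have "\<forall>\<^sub>F r in at_right (0 :: real). 0 < r"
    by (rule eventually_at_right_less)
  ultimately have "\<forall>\<^sub>F r in at_right (0 :: real). Suc N * r powr (1 / (real n + 1)) < (1/2) ^ n \<and>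
      r < 1 / N \<and> r < (1/2) ^ n \<and> 0 < r"
    by eventually_elim simp
  then obtain r :: real where r: "Suc N * r powr (1 / (real n + 1)) < (1/2) ^ n"
      "r < 1 / N" "r < (1/2) ^ n" "0 < r"
    using eventually_happens'[OF trivial_limit_at_right_real] by blast
  obtain g p q where g: "continuous_on {0..1} g" "\<forall>x\<in>{0..1}. \<bar>f x - g x\<bar> \<le> e"
    "\<And>x. (\<exists>j<N. x \<in> {p j..p j + r}) \<or> (\<exists>j\<le>N. g x = q j)"
    using approx[of r] r by auto
  \<comment> \<open>Members of \<open>C01\<close> are extensional.\<close>
  let ?g = "restrict g {0..1}"
  have "strip_covered n h (Suc N) r p (\<lambda>j. q j - r / 2)"
    if h: "\<forall>x\<in>{0..1}. \<bar>?g x - h x\<bar> \<le> r / 2" for h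
    unfolding strip_covered_def
  proof (intro conjI ballI)
    fix x :: real
    assume x: "x \<in> {0..1}"
    consider j where "j < N" "x \<in> {p j..p j + r}" | j where "j \<le> N" "g x = q j"
      using g(3) by blast
    then show "\<exists>j<Suc N. x \<in> {p j..p j + r} \<or> h x \<in> {q j - r / 2..q j - r / 2 + r}"
    proof cases
      case 1
      then show ?thesis by (meson less_SucI)
    next
      case (2 j)
      then have "\<bar>q j - h x\<bar> \<le> r / 2"
        using bspec[OF h x] x by simp
      then have "h x \<in> {q j - r / 2..q j - r / 2 + r}"
        unfolding atLeastAtMost_iff by linarith
      then show ?thesis using 2(1) by (meson le_imp_less_Suc)
    qed
  qed (use r in auto)
  then have "\<forall>h. (\<forall>x\<in>{0..1}. \<bar>?g x - h x\<bar> \<le> r / 2) \<longrightarrow> (\<exists>M r p q. strip_covered n h M r p q)"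
    by blast
  moreover have "?g \<in> mspace C01"
    unfolding mspace_C01 by (auto intro: continuous_on_eq[OF g(1)])
  moreover have "\<forall>x\<in>{0..1}. \<bar>f x - ?g x\<bar> \<le> e"
    using g(2) by simp
  moreover have "0 < r / 2"
    using r(4) by simp
  ultimately show ?thesis
    by blast
qed

theorem corollary1p4:
  shows "typical_in_C01 (\<lambda>f. \<exists>A B :: real set. A \<subseteq> {0..1} \<and>
           lower_packing_dim A = 0 \<and> hausdorff_dim B = 0 \<and>
           {(x, f x) | x. x \<in> {0..1}} \<subseteq> (A \<times> UNIV) \<union> (UNIV \<times> B))"
proof (rule typical_in_C01I[where G = "\<lambda>n. {f. \<exists>M r p q. strip_covered n f M r p q}"])
  fix f :: "real \<Rightarrow> real"
  assume "f \<in> (\<Inter>n. {f. \<exists>M r p q. strip_covered n f M r p q})"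
  then have "\<forall>n. \<exists>M r p q. strip_covered n f M r p q"
    by simp
  then obtain M r p q where "\<And>n. strip_covered n f (M n) (r n) (p n) (q n)"
    by metis
  note sc = this[unfolded strip_covered_def]
  have r: "\<And>n. 0 < r n" "\<And>n. r n \<le> (1/2) ^ n"
      "\<And>n. M n * r n powr (1 / (real n + 1)) \<le> (1/2) ^ n"
    using sc by simp_all
  define V where "V = (\<lambda>n. \<Union>j<M n. {p n j..p n j + r n})"
  define U where "U = (\<lambda>n. \<Union>j<M n. {q n j..q n j + r n})"
  have cover: "x \<in> V n \<or> f x \<in> U n" if x: "x \<in> {0..1}" for n x
  proof -
    obtain j where "j < M n" "x \<in> {p n j..p n j + r n} \<or> f x \<in> {q n j..q n j + r n}"
      using bspec[OF conjunct2[OF conjunct2[OF conjunct2[OF sc[of n]]]] x] by (elim exE conjE)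
    then show ?thesis
      unfolding V_def U_def by (blast intro: UN_I[of j])
  qed
  show "\<exists>A B :: real set. A \<subseteq> {0..1} \<and> lower_packing_dim A = 0 \<and> hausdorff_dim B = 0 \<and>
      {(x, f x) | x. x \<in> {0..1}} \<subseteq> (A \<times> UNIV) \<union> (UNIV \<times> B)"
  proof (intro exI conjI)
    show "lower_packing_dim ({0..1} \<inter> (\<Union>m. \<Inter>n\<in>{m..}. V n)) = 0"
      unfolding V_def by (rule lower_packing_dim_liminf_intervals[OF r])
    show "hausdorff_dim (\<Inter>m. \<Union>n\<in>{m..}. U n) = 0"
      unfolding U_def by (rule hausdorff_dim_limsup_intervals[OF r])
    \<comment> \<open>If \<open>f x\<close> misses \<open>U n\<close> for all \<open>n\<close> from
      some \<open>m\<close> on, then \<open>cover\<close> puts \<open>x\<close> in each of those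
      \<open>V n\<close>.\<close>
    show "{(x, f x) | x. x \<in> {0..1}}
        \<subseteq> ({0..1} \<inter> (\<Union>m. \<Inter>n\<in>{m..}. V n)) \<times> UNIV \<union> UNIV \<times> (\<Inter>m. \<Union>n\<in>{m..}. U n)"
      using cover by fastforce
  qed (rule Int_lower1)
qed (use strip_covered_dense in simp)

end
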